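(* Let $k\ge 2$ be an integer and let $\hat G$ be a signed multigraph. Then $\hat G$ admits an $X_{2k}$-coloring if and only if $T_{2k-2}(\hat G)$ admits a homomorphism to $C_{-2k}$. Moreover, $\hat G$ is $X_{2k}$-critical if and only if $T_{2k-2}(\hat G)$ is $C_{-2k}$-critical.
   Context: Graphs and multigraphs are finite. A signed multigraph $(G,\sigma)$ is a multigraph $G$ with a signature $\sigma:E(G)\to\{+,-\}$. The sign of a walk is the product of the signs of its edges, counted with multiplicity. Switching at a set $X\subseteq V(G)$ means flipping the signs of all edges with exactly one end in $X$; two signatures on $G$ are equivalent if one is obtained from the other by switching. For a signed simple graph $(H,\pi)$, a homomorphism $(G,\sigma)\to(H,\pi)$ exists if and only if there are a signature $\sigma'$ equivalent to $\sigma$ and a map $f:V(G)\to V(H)$ such that for every edge $e$ of $G$ with ends $u,v$, $f(u)f(v)$ is an edge of $H$ with $\pi(f(u)f(v))=\sigma'(e)$. A subgraph of $(G,\sigma)$ is a subgraph of $G$ with the restricted signature. Let $X_{2k}=\{\pm1,\pm2,\dots,\pm k\}$. A signed multigraph $(G,\sigma)$ is $X_{2k}$-colorable (admits an $X_{2k}$-coloring) if there is $c:V(G)\to X_{2k}$ such that $c(x)\ne\sigma(e)c(y)$ for each edge $e$ with endpoints $x,y$ (not necessarily distinct). It is $X_{2k}$-critical if it does not admit an $X_{2k}$-coloring but each of its proper subgraphs does. For a positive integer $m$, $T_m(G,\sigma)$ is the signed graph obtained by replacing each edge $e$ of $G$, with ends $u,v$, by a $u$–$v$ path of length $m$ (with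 new internal vertices; a closed walk along a cycle of length $m$ if $u=v$) whose edges are given signs so that the sign of the path is $-\sigma(e)$ (well defined up to switching). $C_{-2k}$ denotes a signed cycle of length $2k$ with an odd number of negative edges (unique up to switching). For $ij\in\mathbb{Z}_2^2$, $g_{ij}(G,\sigma)$ is the length of a shortest closed walk whose number of negative edges is congruent to $i$ modulo 2 and whose length is congruent to $j$ modulo 2 ($\infty$ if none exists). A signed graph $(G,\sigma)$ is $(H,\pi)$-critical if: $g_{ij}(G,\sigma)\ge g_{ij}(H,\pi)$ for each $ij\in\mathbb{Z}_2^2$; $(G,\sigma)$ admits no homomorphism to $(H,\pi)$; and every proper subgraph of $(G,\sigma)$ admits a homomorphism to $(H,\pi)$.
   Formalization: The criticality equivalence excludes the graph with one vertex and one positive loop: it is X_{2k}-critical, but its T_{2k-2} is a negative cycle of length 2k-2 < 2k, so it is not C_{-2k}-critical and the claim fails there. *)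

theory Defs
  imports Main "HOL-Library.Extended_Nat" "HOL-Library.Z2"
begin

text \<open>A loop at \<open>u\<close> is an edge whose set of ends is \<open>{u}\<close>. Signs are the integers \<open>1\<close> and \<open>-1\<close>.\<close>

record ('v, 'e) signed_multigraph =
  verts :: "'v set"
  edges :: "'e set"
  ends :: "'e \<Rightarrow> 'v set"
  sign :: "'e \<Rightarrow> int"

definition wf_graph :: "('v, 'e) signed_multigraph \<Rightarrow> bool" where
  "wf_graph G \<longleftrightarrow> finite (verts G) \<and> finite (edges G) \<and>
     (\<forall>e\<in>edges G. \<exists>u\<in>verts G. \<exists>v\<in>verts G. ends G e = {u, v}) \<and>
     (\<forall>e\<in>edges G. sign G e \<in> {1, -1})"

definition proper_subgraph ::
  "('v, 'e) signed_multigraph \<Rightarrow> ('v, 'e) signed_multigraph \<Rightarrow> bool" where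
  "proper_subgraph S G \<longleftrightarrow> wf_graph S \<and> verts S \<subseteq> verts G \<and> edges S \<subseteq> edges G \<and>
     (\<forall>e\<in>edges S. ends S e = ends G e \<and> sign S e = sign G e) \<and>
     (verts S \<noteq> verts G \<or> edges S \<noteq> edges G)"

text \<open>A loop never has exactly one end in \<open>X\<close>, so its sign is unchanged by switching; counting
  the elements of \<open>ends G e \<inter> X\<close> would get this wrong.\<close>

definition switched_sign :: "('v, 'e) signed_multigraph \<Rightarrow> 'v set \<Rightarrow> 'e \<Rightarrow> int" where
  "switched_sign G X e =
     (if \<exists>u v. ends G e = {u, v} \<and> u \<in> X \<and> v \<notin> X then - sign G e else sign G e)"

definition switching_equivalent :: "('v, 'e) signed_multigraph \<Rightarrow> ('e \<Rightarrow> int) \<Rightarrow> bool" where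
  "switching_equivalent G \<sigma>' \<longleftrightarrow>
     (\<exists>X \<subseteq> verts G. \<forall>e\<in>edges G. \<sigma>' e = switched_sign G X e)"

text \<open>Used only for simple targets \<open>H\<close>, where the edge \<open>d\<close> below is unique.\<close>

definition sg_hom :: "('v, 'e) signed_multigraph \<Rightarrow> ('w, 'f) signed_multigraph \<Rightarrow> bool" where
  "sg_hom G H \<longleftrightarrow> (\<exists>\<sigma>' f. switching_equivalent G \<sigma>' \<and> f ` verts G \<subseteq> verts H \<and>
     (\<forall>e\<in>edges G. \<forall>u v. ends G e = {u, v} \<longrightarrow>
        (\<exists>d\<in>edges H. ends H d = {f u, f v} \<and> sign H d = \<sigma>' e)))"

definition X_colors :: "nat \<Rightarrow> int set" where
  "X_colors k = {1..int k} \<union> {- int k..-1}"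

definition X_colorable :: "nat \<Rightarrow> ('v, 'e) signed_multigraph \<Rightarrow> bool" where
  "X_colorable k G \<longleftrightarrow> (\<exists>c. c ` verts G \<subseteq> X_colors k \<and>
     (\<forall>e\<in>edges G. \<forall>x y. ends G e = {x, y} \<longrightarrow> c x \<noteq> sign G e * c y))"

definition X_critical :: "nat \<Rightarrow> ('v, 'e) signed_multigraph \<Rightarrow> bool" where
  "X_critical k G \<longleftrightarrow> \<not> X_colorable k G \<and> (\<forall>S. proper_subgraph S G \<longrightarrow> X_colorable k S)"

text \<open>The vertices of \<open>T\<close> are the old vertices \<open>Inl v\<close> and the new internal vertices
  \<open>Inr (e, i)\<close> with \<open>0 < i < m\<close>; its edges are the pairs \<open>(e, i)\<close> with \<open>i < m\<close>, the pair \<open>(e, i)\<close>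
  being the edge number \<open>i\<close> of the path replacing \<open>e\<close>. As the construction determines the
  signature only up to switching (and leaves the direction in which the path is numbered open),
  this is a relation satisfied by every admissible choice.\<close>

definition path_vertex :: "nat \<Rightarrow> 'e \<Rightarrow> 'v \<Rightarrow> 'v \<Rightarrow> nat \<Rightarrow> 'v + 'e \<times> nat" where
  "path_vertex m e u v i = (if i = 0 then Inl u else if i = m then Inl v else Inr (e, i))"

definition is_T :: "nat \<Rightarrow> ('v, 'e) signed_multigraph \<Rightarrow>
    ('v + 'e \<times> nat, 'e \<times> nat) signed_multigraph \<Rightarrow> bool" where
  "is_T m G T \<longleftrightarrow>
     verts T = Inl ` verts G \<union> Inr ` (edges G \<times> {0<..<m}) \<and>
     edges T = edges G \<times> {..<m} \<and>
     (\<forall>e\<in>edges G. \<exists>u v. ends G e = {u, v} \<and>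
        (\<forall>i<m. ends T (e, i) = {path_vertex m e u v i, path_vertex m e u v (Suc i)})) \<and>
     (\<forall>d\<in>edges T. sign T d \<in> {1, -1}) \<and>
     (\<forall>e\<in>edges G. (\<Prod>i<m. sign T (e, i)) = - sign G e)"

definition is_negative_cycle :: "nat \<Rightarrow> ('w, 'f) signed_multigraph \<Rightarrow> bool" where
  "is_negative_cycle n C \<longleftrightarrow> wf_graph C \<and>
     (\<exists>p d. bij_betw p {..<n} (verts C) \<and> bij_betw d {..<n} (edges C) \<and>
        (\<forall>i<n. ends C (d i) = {p i, p (Suc i mod n)})) \<and>
     odd (card {e \<in> edges C. sign C e = -1})"

text \<open>A walk is given by its first vertex, its list of edges and its last vertex; these
  determine the vertices in between.\<close>

inductive walk :: "('v, 'e) signed_multigraph \<Rightarrow> 'v \<Rightarrow> 'e list \<Rightarrow> 'v \<Rightarrow> bool"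
  for G where
  Nil: "u \<in> verts G \<Longrightarrow> walk G u [] u"
| Cons: "e \<in> edges G \<Longrightarrow> ends G e = {u, v} \<Longrightarrow> walk G v es w \<Longrightarrow> walk G u (e # es) w"

text \<open>The type \<open>bit\<close> is the two-element field, so the equations below are congruences modulo 2.
  The walk of length 0 is not counted; the infimum of the empty set is \<open>\<infinity>\<close>.\<close>

definition gij :: "bit \<Rightarrow> bit \<Rightarrow> ('v, 'e) signed_multigraph \<Rightarrow> enat" where
  "gij i j G = Inf {enat (length es) | es. es \<noteq> [] \<and> (\<exists>u. walk G u es u) \<and>
     of_nat (length (filter (\<lambda>e. sign G e = -1) es)) = i \<and> of_nat (length es) = j}"

definition hom_critical ::
  "('w, 'f) signed_multigraph \<Rightarrow> ('v, 'e) signed_multigraph \<Rightarrow> bool" where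
  "hom_critical H G \<longleftrightarrow> (\<forall>i j. gij i j H \<le> gij i j G) \<and> \<not> sg_hom G H \<and>
     (\<forall>S. proper_subgraph S G \<longrightarrow> sg_hom S H)"

text \<open>The equivalence of the two notions of criticality has one exception: this graph is
  \<open>X_critical k\<close>, but the cycle replacing its loop is negative of length \<open>2k - 2\<close>, so that
  \<open>gij 1 0\<close> is smaller for it than for a negative cycle of length \<open>2k\<close>.\<close>

definition single_positive_loop :: "('v, 'e) signed_multigraph \<Rightarrow> bool" where
  "single_positive_loop G \<longleftrightarrow>
     (\<exists>v e. verts G = {v} \<and> edges G = {e} \<and> ends G e = {v} \<and> sign G e = 1)"

end

theory Submission
  imports Defs
begin

text \<open>A homomorphism to the negative cycle of length \<open>2k\<close> is the same as a map \<open>\<phi>\<close> to the integers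
  modulo \<open>4k\<close> (the double cover of the cycle) whose increment along an edge is \<open>\<plusminus>1\<close> if the edge is
  positive and \<open>2k \<plusminus> 1\<close> if it is negative. Along a path of length \<open>2k - 2\<close> and sign \<open>- g\<close> exactly the
  increments \<open>k(1 + g) + D\<close> with \<open>D\<close> even and \<open>\<bar>D\<bar> \<le> 2k - 2\<close> can be realised: these are all even
  residues but \<open>k(1 - g)\<close>. Hence \<open>\<phi>\<close> exists on the subdivision iff the vertices of the original
  graph can be given even residues, i.e. colors in \<open>X\<^sub>2\<^sub>k\<close> with negation corresponding to adding \<open>2k\<close>,
  such that the forbidden increment never occurs. If an edge of the path is missing, there is no
  constraint at all, which transfers criticality. As for the girth condition, a negative closed
  walk that misses an edge lies in a proper subgraph and is mapped to \<open>C\<^sub>-\<^sub>2\<^sub>k\<close>; one that uses all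
  edges has length at least \<open>2(2k - 2) \<ge> 2k\<close>, since a critical graph other than a single positive
  loop has at least two edges.\<close>

section \<open>Unit steps and sign offsets modulo 4k\<close>

text \<open>The summand \<open>k(1 - s)\<close> encodes the sign \<open>s\<close> as \<open>0\<close> or \<open>2k\<close>; modulo \<open>4k\<close> it turns products
  of signs into sums.\<close>

definition circ_step :: "nat \<Rightarrow> int \<Rightarrow> int \<Rightarrow> bool" where
  "circ_step k s x \<longleftrightarrow> (\<exists>r\<in>{1, -1}. 4 * int k dvd x - int k * (1 - s) - r)"

text \<open>Integers stand for residues modulo 4k. As \<open>{u, v}\<close> is unordered, the
  increment and its negative are both constrained; for signs in \<open>{1, -1}\<close> this is one
  condition, by \<open>circ_step_uminus\<close>.\<close>

definition circ_map :: "nat \<Rightarrow> ('v, 'e) signed_multigraph \<Rightarrow> ('v \<Rightarrow> int) \<Rightarrow> bool" where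
  "circ_map k G \<phi> \<longleftrightarrow>
     (\<forall>e\<in>edges G. \<forall>u v. ends G e = {u, v} \<longrightarrow> circ_step k (sign G e) (\<phi> v - \<phi> u))"

text \<open>Sending 1 to 0 and -1 to 2k is a homomorphism from signs to residues modulo 4k; the only
  nonzero difference is -4k, at s = t = -1.\<close>

lemma sign_offset_add:
  assumes "s \<in> {1, -1::int}" "t \<in> {1, -1}"
  shows "4 * int k dvd int k * (1 - s * t) - int k * (1 - s) - int k * (1 - t)"
  using assms by auto

text \<open>The residue 2k is its own negative modulo 4k, so negation merely exchanges the two
  choices of \<open>r\<close>.\<close>

lemma circ_step_uminus:
  assumes "s \<in> {1, -1}" "circ_step k s x"
  shows "circ_step k s (- x)"
proof -
  obtain r where r: "r \<in> {1, -1}" "4 * int k dvd x - int k * (1 - s) - r"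
    using assms(2) unfolding circ_step_def by blast
  have "4 * int k dvd 2 * int k * (1 - s)" using assms(1) by auto
  from dvd_diff[OF dvd_minus_iff[THEN iffD2, OF r(2)] this]
  have "4 * int k dvd - x - int k * (1 - s) - (- r)" by (simp add: algebra_simps)
  thus ?thesis using r(1) unfolding circ_step_def by (intro bexI[of _ "- r"]) auto
qed

text \<open>If the value at position \<open>i\<close> of a path carries the offset of the product of
  the first \<open>i\<close> signs, its increment carries the offset of the single sign
  \<open>s i\<close>. All maps along paths are built this way.\<close>

lemma circ_step_prod:
  fixes i :: nat
  assumes "s i \<in> {1, -1::int}" "(\<Prod>j<i. s j) \<in> {1, -1}" "r \<in> {1, -1}"
    "x = int k * (1 - (\<Prod>j<Suc i. s j)) - int k * (1 - (\<Prod>j<i. s j)) + r"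
  shows "circ_step k (s i) x"
proof -
  have "x - int k * (1 - s i) - r = int k * (1 - (\<Prod>j<i. s j) * s i)
      - int k * (1 - (\<Prod>j<i. s j)) - int k * (1 - s i)"
    using assms(4) by simp
  hence "4 * int k dvd x - int k * (1 - s i) - r"
    using sign_offset_add[OF assms(2,1), of k] by (simp only:)
  thus ?thesis using assms(3) by (auto simp: circ_step_def)
qed

lemma prod_signs:
  fixes n :: nat
  assumes "\<And>j. j < n \<Longrightarrow> s j \<in> {1, -1::int}"
  shows "(\<Prod>j<n. s j) \<in> {1, -1}"
  using assms
proof (induction n)
  case (Suc n)
  then have "(\<Prod>j<n. s j) \<in> {1, -1}" "s n \<in> {1, -1}" by auto
  thus ?case by auto
qed simp

lemma prod_list_signs:
  assumes "\<And>e. e \<in> set es \<Longrightarrow> s e \<in> {1, -1::int}"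
  shows "prod_list (map s es) = (-1) ^ length (filter (\<lambda>e. s e = -1) es)"
  using assms by (induction es) auto

section \<open>Displacement along walks\<close>

lemma walk_edges: "walk G u es w \<Longrightarrow> set es \<subseteq> edges G"
  by (induction rule: walk.induct) auto

text \<open>Every edge contributes the offset of its sign and a unit step. Modulo 4k the offsets add
  up to that of the product of the signs, and \<open>D\<close> is the sum of the unit steps.\<close>

lemma walk_displacement:
  assumes sg: "\<forall>e\<in>edges G. sign G e \<in> {1, -1}" and c: "circ_map k G \<phi>" and w: "walk G u es w"
  shows "\<exists>D. \<bar>D\<bar> \<le> int (length es) \<and> even (D - int (length es)) \<and>
    4 * int k dvd \<phi> w - \<phi> u - int k * (1 - prod_list (map (sign G) es)) - D"
  using w
proof (induction rule: walk.induct)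
  case (Nil u)
  show ?case by (intro exI[of _ 0]) auto
next
  case (Cons e u v es w)
  obtain D where D: "\<bar>D\<bar> \<le> int (length es)" "even (D - int (length es))"
    "4 * int k dvd \<phi> w - \<phi> v - int k * (1 - prod_list (map (sign G) es)) - D"
    using Cons.IH by blast
  have "circ_step k (sign G e) (\<phi> v - \<phi> u)" using c Cons.hyps by (auto simp: circ_map_def)
  then obtain r where r: "r \<in> {1, -1}" "4 * int k dvd \<phi> v - \<phi> u - int k * (1 - sign G e) - r"
    unfolding circ_step_def by blast
  have "set es \<subseteq> edges G" using Cons.hyps(3) by (rule walk_edges)
  hence "prod_list (map (sign G) es) = (-1) ^ length (filter (\<lambda>e. sign G e = -1) es)"
    using sg by (intro prod_list_signs) auto
  hence P: "prod_list (map (sign G) es) \<in> {1, -1}" by (auto simp: minus_one_power_iff)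
  have s: "sign G e \<in> {1, -1}" using sg Cons.hyps by auto
  have "4 * int k dvd \<phi> w - \<phi> u - int k * (1 - prod_list (map (sign G) (e # es))) - (D + r)"
    using dvd_diff[OF dvd_add[OF D(3) r(2)] sign_offset_add[OF s P, of k]]
    by (simp add: algebra_simps)
  moreover have "\<bar>D + r\<bar> \<le> int (length (e # es))" "even (D + r - int (length (e # es)))"
    using D r(1) by auto
  ultimately show ?case by blast
qed

text \<open>A closed walk has displacement 0, and a negative one has offset 2k, so \<open>D\<close>
  is congruent to 2k modulo 4k and has absolute value at least 2k.\<close>

lemma closed_walk_length:
  assumes "k > 0" and sg: "\<forall>e\<in>edges G. sign G e \<in> {1, -1}" and c: "circ_map k G \<phi>"
    and w: "walk G u es u" and odd: "odd (length (filter (\<lambda>e. sign G e = -1) es))"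
  shows "2 * k \<le> length es"
proof -
  have "set es \<subseteq> edges G" using w by (rule walk_edges)
  hence "prod_list (map (sign G) es) = -1"
    using sg odd prod_list_signs[of es "sign G"] by auto
  then obtain D where D: "\<bar>D\<bar> \<le> int (length es)" "4 * int k dvd - int k * 2 - D"
    using walk_displacement[OF sg c w] by auto
  show ?thesis
  proof (rule ccontr)
    assume "\<not> ?thesis"
    hence "\<bar>D\<bar> < 2 * int k" using D(1) by linarith
    moreover have "4 * int k dvd 2 * int k + D" using D(2)
      by (metis dvd_minus_iff minus_diff_eq diff_minus_eq_add mult.commute mult_minus_left add.commute)
    ultimately show False using zdvd_imp_le[of "4 * int k" "2 * int k + D"] by linarith
  qed
qed

section \<open>Colors as residues modulo 2k\<close>

text \<open>The residues 0, ..., 2k - 1 become 1, ..., k, -1, ..., -k in this order, so that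
  negating a color is the shift by k.\<close>

definition color :: "nat \<Rightarrow> int \<Rightarrow> int" where
  "color k i = (let r = i mod (2 * int k) in if r < int k then r + 1 else int k - 1 - r)"

lemma color_in_X_colors:
  assumes "k > 0" shows "color k i \<in> X_colors k"
proof -
  have "0 \<le> i mod (2 * int k)" "i mod (2 * int k) < 2 * int k" using assms by simp_all
  thus ?thesis unfolding color_def X_colors_def Let_def by auto
qed

lemma ex_color:
  assumes "c \<in> X_colors k" shows "\<exists>i. color k i = c"
proof (cases "c > 0")
  case True
  hence "color k (c - 1) = c" using assms by (auto simp: color_def X_colors_def)
  thus ?thesis ..
next
  case False
  hence "color k (int k - 1 - c) = c" using assms by (auto simp: color_def X_colors_def)
  thus ?thesis ..
qed

lemma color_eq_iff:
  assumes "k > 0" shows "color k i = color k j \<longleftrightarrow> 2 * int k dvd i - j"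
proof -
  have inj: "(if r < int k then r + 1 else int k - 1 - r) = (if q < int k then q + 1 else int k - 1 - q)
      \<longleftrightarrow> r = q" if "0 \<le> r" "0 \<le> q" for r q :: int
    using that by auto
  have "color k i = color k j \<longleftrightarrow> i mod (2 * int k) = j mod (2 * int k)"
    unfolding color_def Let_def using assms by (intro inj) simp_all
  thus ?thesis by (simp add: mod_eq_dvd_iff)
qed

lemma color_antipode:
  assumes "k > 0" shows "color k (i + int k) = - color k i"
proof -
  let ?r = "i mod (2 * int k)"
  have r: "0 \<le> ?r" "?r < 2 * int k" using assms by auto
  have "(i + int k) mod (2 * int k) = (?r + int k) mod (2 * int k)" by (simp add: mod_add_left_eq)
  also have "\<dots> = (if ?r < int k then ?r + int k else ?r - int k)"
  proof (cases "?r < int k")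
    case False
    have "(?r + int k) mod (2 * int k) = (?r - int k + 2 * int k) mod (2 * int k)"
      by (simp add: algebra_simps)
    also have "\<dots> = (?r - int k) mod (2 * int k)" by (rule mod_add_self2)
    also have "\<dots> = ?r - int k" using False r by (intro mod_pos_pos_trivial) auto
    finally show ?thesis using False by simp
  qed (use r in auto)
  finally show ?thesis using r by (auto simp: color_def Let_def)
qed

text \<open>Doubling turns congruence modulo 2k into congruence modulo 4k, and the shift by k that
  negates a color into the shift by 2k, the offset of the sign -1. Colors thereby become even
  residues modulo 4k.\<close>

lemma color_eq_sign_iff:
  assumes "k > 0" "g \<in> {1, -1}"
  shows "color k i = g * color k j \<longleftrightarrow> 4 * int k dvd 2 * i - 2 * j - int k * (1 - g)"
proof -
  have dbl: "2 * int k dvd x \<longleftrightarrow> 4 * int k dvd 2 * x" for x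
    using dvd_mult_cancel_left[of 2 "2 * int k" x] by simp
  show ?thesis
  proof (cases "g = 1")
    case True
    thus ?thesis using color_eq_iff[OF assms(1), of i j] dbl[of "i - j"] by (simp add: algebra_simps)
  next
    case False
    hence g: "g = -1" using assms by auto
    have "color k i = g * color k j \<longleftrightarrow> color k i = color k (j + int k)"
      using color_antipode[OF assms(1), of j] g by simp
    also have "\<dots> \<longleftrightarrow> 4 * int k dvd 2 * (i - (j + int k))"
      using color_eq_iff[OF assms(1)] dbl by simp
    finally show ?thesis using g by (simp add: algebra_simps)
  qed
qed

text \<open>The doubled indices \<open>2 * \<iota> v\<close> will be the values of a
  \<open>circ_map\<close> at the old vertices; an edge of sign g forbids just the increment k(1 -
  g). The criterion speaks of edges only and thus ignores isolated vertices.\<close>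

lemma X_colorable_iff:
  assumes k: "k > 0" and wf: "wf_graph G"
  shows "X_colorable k G \<longleftrightarrow> (\<exists>\<iota>. \<forall>e\<in>edges G. \<forall>u v. ends G e = {u, v} \<longrightarrow>
    \<not> 4 * int k dvd 2 * \<iota> u - 2 * \<iota> v - int k * (1 - sign G e))"
proof
  assume "X_colorable k G"
  then obtain c where c: "c ` verts G \<subseteq> X_colors k"
    "\<And>e x y. e \<in> edges G \<Longrightarrow> ends G e = {x, y} \<Longrightarrow> c x \<noteq> sign G e * c y"
    by (auto simp: X_colorable_def)
  have "\<forall>v\<in>verts G. \<exists>i. color k i = c v" using c(1) ex_color by blast
  then obtain \<iota> where \<iota>: "\<And>v. v \<in> verts G \<Longrightarrow> color k (\<iota> v) = c v" by metis
  have "\<not> 4 * int k dvd 2 * \<iota> u - 2 * \<iota> v - int k * (1 - sign G e)"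
    if "e \<in> edges G" "ends G e = {u, v}" for e u v
  proof -
    have "sign G e \<in> {1, -1}" using wf that by (auto simp: wf_graph_def)
    moreover have "u \<in> verts G" "v \<in> verts G"
      using wf that unfolding wf_graph_def by (metis doubleton_eq_iff)+
    ultimately show ?thesis using c(2)[OF that] color_eq_sign_iff[OF k] \<iota> by metis
  qed
  thus "\<exists>\<iota>. \<forall>e\<in>edges G. \<forall>u v. ends G e = {u, v} \<longrightarrow>
    \<not> 4 * int k dvd 2 * \<iota> u - 2 * \<iota> v - int k * (1 - sign G e)" by blast
next
  assume "\<exists>\<iota>. \<forall>e\<in>edges G. \<forall>u v. ends G e = {u, v} \<longrightarrow>
    \<not> 4 * int k dvd 2 * \<iota> u - 2 * \<iota> v - int k * (1 - sign G e)"
  then obtain \<iota> where \<iota>: "\<And>e u v. e \<in> edges G \<Longrightarrow> ends G e = {u, v} \<Longrightarrow>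
    \<not> 4 * int k dvd 2 * \<iota> u - 2 * \<iota> v - int k * (1 - sign G e)" by blast
  have "sign G e \<in> {1, -1}" if "e \<in> edges G" for e using wf that by (auto simp: wf_graph_def)
  hence "color k (\<iota> x) \<noteq> sign G e * color k (\<iota> y)"
    if "e \<in> edges G" "ends G e = {x, y}" for e x y
    using color_eq_sign_iff[OF k] \<iota>[OF that] that by metis
  thus "X_colorable k G" unfolding X_colorable_def
    using color_in_X_colors[OF k] by (intro exI[of _ "\<lambda>v. color k (\<iota> v)"]) blast
qed

text \<open>Serves to exclude isolated vertices from critical graphs: deleting one cannot make an
  uncolorable graph colorable.\<close>

lemma X_colorable_cong_edges:
  assumes "k > 0" "wf_graph G" "wf_graph S" "edges S = edges G"
    "\<forall>e\<in>edges S. ends S e = ends G e \<and> sign S e = sign G e" "X_colorable k S"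
  shows "X_colorable k G"
  using assms X_colorable_iff[OF assms(1,2)] X_colorable_iff[OF assms(1,3)] by simp

section \<open>Prescribed increments along signed paths\<close>

text \<open>The last step is taken in the direction of \<open>D\<close>; what remains is reached in
  one step less.\<close>

lemma ex_zigzag:
  "\<bar>D\<bar> \<le> int m \<Longrightarrow> even (D - int m) \<Longrightarrow>
    \<exists>z. z 0 = 0 \<and> z m = D \<and> (\<forall>i<m. z (Suc i) - z i \<in> {1, -1::int})"
proof (induction m arbitrary: D)
  case 0
  thus ?case by (intro exI[of _ "\<lambda>_. 0"]) auto
next
  case (Suc m)
  obtain r where r: "r \<in> {1, -1::int}" "\<bar>D - r\<bar> \<le> int m"
  proof (cases "D > 0")
    case True
    thus ?thesis using that[of 1] Suc.prems by auto
  next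
    case False
    \<comment> \<open>If \<open>D = 0\<close>, the step -1 leaves a displacement of 1, and parity
      makes \<open>m\<close> odd, hence at least 1.\<close>
    thus ?thesis using that[of "-1"] Suc.prems by (cases "D = 0"; cases m) auto
  qed
  have "even (D - r - int m)" using Suc.prems r(1) by auto
  with Suc.IH[OF r(2)] obtain z
    where z: "z 0 = 0" "z m = D - r" "\<forall>i<m. z (Suc i) - z i \<in> {1, -1::int}" by blast
  have "\<forall>i<Suc m. (z(Suc m := D)) (Suc i) - (z(Suc m := D)) i \<in> {1, -1}"
    using z r(1) by (auto simp: less_Suc_eq)
  thus ?case using z by (intro exI[of _ "z(Suc m := D)"]) auto
qed

lemma circ_step_cong:
  assumes "circ_step k s x" "4 * int k dvd y - x"
  shows "circ_step k s y"
proof -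
  obtain r where r: "r \<in> {1, -1}" "4 * int k dvd x - int k * (1 - s) - r"
    using assms(1) unfolding circ_step_def by blast
  have "4 * int k dvd y - int k * (1 - s) - r"
    using dvd_add[OF r(2) assms(2)] by (simp add: algebra_simps)
  thus ?thesis using r(1) by (auto simp: circ_step_def)
qed

text \<open>The converse of \<open>walk_displacement\<close> for a path: a zigzag of total
  \<open>D\<close> is superposed on the offsets of the partial products.\<close>

lemma ex_circ_path:
  assumes s: "\<And>i. i < m \<Longrightarrow> s i \<in> {1, -1::int}" and m: "m > 0"
    and D: "\<bar>D\<bar> \<le> int m" "even (D - int m)"
    and b: "4 * int k dvd b - a - int k * (1 - (\<Prod>i<m. s i)) - D"
  shows "\<exists>\<psi>. \<psi> 0 = a \<and> \<psi> m = b \<and> (\<forall>i<m. circ_step k (s i) (\<psi> (Suc i) - \<psi> i))"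
proof -
  obtain z where z: "z 0 = 0" "z m = D" "\<forall>i<m. z (Suc i) - z i \<in> {1, -1::int}"
    using ex_zigzag[OF D] by blast
  define F where "F i = a + int k * (1 - (\<Prod>j<i. s j)) + z i" for i
  have step: "circ_step k (s i) (F (Suc i) - F i)" if "i < m" for i
  proof (rule circ_step_prod)
    show "(\<Prod>j<i. s j) \<in> {1, -1}" using s that by (intro prod_signs) auto
    show "z (Suc i) - z i \<in> {1, -1}" using z that by auto
  qed (use s that in \<open>auto simp: F_def algebra_simps\<close>)
  \<comment> \<open>\<open>F m\<close> agrees with \<open>b\<close> only modulo 4k. Overwriting it
    yields the exact end value and keeps the last step valid; as \<open>m > 0\<close>, the value at
    0 is unaffected.\<close>
  have "circ_step k (s i) ((F(m := b)) (Suc i) - (F(m := b)) i)" if "i < m" for i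
  proof (rule circ_step_cong[OF step[OF that]])
    show "4 * int k dvd (F(m := b)) (Suc i) - (F(m := b)) i - (F (Suc i) - F i)"
      using that b z(2) by (auto simp: F_def algebra_simps)
  qed
  moreover have "(F(m := b)) 0 = a" using m z by (auto simp: F_def)
  ultimately show ?thesis by (intro exI[of _ "F(m := b)"]) auto
qed

text \<open>The piece up to \<open>l\<close> and the piece after \<open>l\<close> share no
  constraint, so the first is translated to start at \<open>a\<close> and the second to end at
  \<open>b\<close>. All unit steps are +1.\<close>

lemma ex_circ_broken_path:
  assumes s: "\<And>i. i < m \<Longrightarrow> s i \<in> {1, -1::int}" and l: "l < m"
  shows "\<exists>\<psi>. \<psi> 0 = a \<and> \<psi> m = b \<and>
    (\<forall>i<m. i \<noteq> l \<longrightarrow> circ_step k (s i) (\<psi> (Suc i) - \<psi> i))"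
proof -
  define F where "F i = int k * (1 - (\<Prod>j<i. s j)) + int i" for i
  define \<psi> where "\<psi> i = (if i \<le> l then a - F 0 + F i else b - F m + F i)" for i
  have "circ_step k (s i) (\<psi> (Suc i) - \<psi> i)" if "i < m" "i \<noteq> l" for i
  proof (rule circ_step_prod)
    show "(\<Prod>j<i. s j) \<in> {1, -1}" using s that by (intro prod_signs) auto
    show "(1::int) \<in> {1, -1}" by simp
  qed (use s that in \<open>auto simp: \<psi>_def F_def algebra_simps\<close>)
  thus ?thesis using l by (intro exI[of _ \<psi>]) (auto simp: \<psi>_def)
qed

section \<open>Colorings of the graph and maps on its subdivision\<close>

lemma subdivision_ends:
  assumes "is_T m G T" "e \<in> edges G"
  obtains u v where "ends G e = {u, v}"
    "\<forall>i<m. ends T (e, i) = {path_vertex m e u v i, path_vertex m e u v (Suc i)}"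
proof -
  have "\<forall>e\<in>edges G. \<exists>u v. ends G e = {u, v} \<and>
      (\<forall>i<m. ends T (e, i) = {path_vertex m e u v i, path_vertex m e u v (Suc i)})"
    using assms(1) by (simp add: is_T_def)
  thus ?thesis using assms(2) that by metis
qed

text \<open>Maps along the paths agree with \<open>\<phi>\<close> at the old vertices, where alone
  the paths meet, and so glue together. Allowing \<open>S\<close> to lack edges of \<open>T\<close>
  covers both \<open>T\<close> itself and its proper subgraphs.\<close>

lemma circ_map_subdivision:
  assumes T: "is_T m G T" and m: "m > 0" and S: "edges S \<subseteq> edges T"
    "\<forall>d\<in>edges S. ends S d = ends T d \<and> sign S d = sign T d"
    and path: "\<And>e u v. e \<in> edges G \<Longrightarrow> ends G e = {u, v} \<Longrightarrow>
      \<exists>\<psi>. \<psi> 0 = \<phi> u \<and> \<psi> m = \<phi> v \<and>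
        (\<forall>i<m. (e, i) \<in> edges S \<longrightarrow> circ_step k (sign T (e, i)) (\<psi> (Suc i) - \<psi> i))"
  shows "\<exists>\<phi>. circ_map k S \<phi>"
proof -
  \<comment> \<open>For each edge the order of its ends is fixed to be the one in which
    \<open>T\<close> numbers the path.\<close>
  have "\<forall>e\<in>edges G. \<exists>u v \<psi>. ends G e = {u, v} \<and>
     (\<forall>i<m. ends T (e, i) = {path_vertex m e u v i, path_vertex m e u v (Suc i)}) \<and>
     \<psi> 0 = \<phi> u \<and> \<psi> m = \<phi> v \<and>
     (\<forall>i<m. (e, i) \<in> edges S \<longrightarrow> circ_step k (sign T (e, i)) (\<psi> (Suc i) - \<psi> i))"
  proof
    fix e assume e: "e \<in> edges G"
    obtain u v where uv: "ends G e = {u, v}"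
      "\<forall>i<m. ends T (e, i) = {path_vertex m e u v i, path_vertex m e u v (Suc i)}"
      by (rule subdivision_ends[OF T e])
    show "\<exists>u v \<psi>. ends G e = {u, v} \<and>
     (\<forall>i<m. ends T (e, i) = {path_vertex m e u v i, path_vertex m e u v (Suc i)}) \<and>
     \<psi> 0 = \<phi> u \<and> \<psi> m = \<phi> v \<and>
     (\<forall>i<m. (e, i) \<in> edges S \<longrightarrow> circ_step k (sign T (e, i)) (\<psi> (Suc i) - \<psi> i))"
      using path[OF e uv(1)] uv by blast
  qed
  then obtain U V \<Psi> where E: "\<And>e i. e \<in> edges G \<Longrightarrow> i < m \<Longrightarrow>
       ends T (e, i) = {path_vertex m e (U e) (V e) i, path_vertex m e (U e) (V e) (Suc i)}"
     "\<And>e. e \<in> edges G \<Longrightarrow> \<Psi> e 0 = \<phi> (U e) \<and> \<Psi> e m = \<phi> (V e)"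
     "\<And>e i. e \<in> edges G \<Longrightarrow> i < m \<Longrightarrow> (e, i) \<in> edges S \<Longrightarrow>
       circ_step k (sign T (e, i)) (\<Psi> e (Suc i) - \<Psi> e i)"
    by metis
  define \<Phi> where "\<Phi> x = (case x of Inl v \<Rightarrow> \<phi> v | Inr (e, i) \<Rightarrow> \<Psi> e i)" for x
  have \<Phi>: "\<Phi> (path_vertex m e (U e) (V e) i) = \<Psi> e i" if "e \<in> edges G" for e i
    using E(2)[OF that] by (auto simp: \<Phi>_def path_vertex_def)
  have "circ_step k (sign S d) (\<Phi> v - \<Phi> u)" if d: "d \<in> edges S" "ends S d = {u, v}" for d u v
  proof -
    obtain e i where ei: "d = (e, i)" "e \<in> edges G" "i < m"
      using d(1) S(1) T by (auto simp: is_T_def)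
    have sg: "sign S d = sign T d" "sign T d \<in> {1, -1}" using d S T by (auto simp: is_T_def)
    have st: "circ_step k (sign S d) (\<Psi> e (Suc i) - \<Psi> e i)"
      using E(3)[OF ei(2,3)] d sg ei by simp
    have "{u, v} = {path_vertex m e (U e) (V e) i, path_vertex m e (U e) (V e) (Suc i)}"
      using E(1)[OF ei(2,3)] d S(2) ei(1) by auto
    hence "\<Phi> v - \<Phi> u = \<Psi> e (Suc i) - \<Psi> e i \<or> \<Phi> v - \<Phi> u = - (\<Psi> e (Suc i) - \<Psi> e i)"
      using \<Phi>[OF ei(2)] by (auto simp: doubleton_eq_iff)
    thus ?thesis using st circ_step_uminus[OF _ st] sg by metis
  qed
  thus ?thesis unfolding circ_map_def by blast
qed

lemma path_vertex_mem:
  assumes "is_T m G T" "e \<in> edges G" "u \<in> verts G" "v \<in> verts G" "i \<le> m"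
  shows "path_vertex m e u v i \<in> verts T"
  using assms by (auto simp: is_T_def path_vertex_def)

lemma wf_graph_subdivision:
  assumes wf: "wf_graph G" and T: "is_T m G T"
  shows "wf_graph T"
proof -
  have ends: "\<exists>x\<in>verts T. \<exists>y\<in>verts T. ends T (e, i) = {x, y}"
    if e: "e \<in> edges G" and i: "i < m" for e i
  proof -
    obtain u v where uv: "ends G e = {u, v}"
      "\<forall>i<m. ends T (e, i) = {path_vertex m e u v i, path_vertex m e u v (Suc i)}"
      by (rule subdivision_ends[OF T e])
    have "u \<in> verts G" "v \<in> verts G"
      using wf e uv(1) unfolding wf_graph_def by (metis doubleton_eq_iff)+
    hence "path_vertex m e u v i \<in> verts T" "path_vertex m e u v (Suc i) \<in> verts T"
      using path_vertex_mem[OF T e] i by auto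
    thus ?thesis using uv(2) i by blast
  qed
  have E: "edges T = edges G \<times> {..<m}"
    and V: "verts T = Inl ` verts G \<union> Inr ` (edges G \<times> {0<..<m})"
    and sg: "\<forall>d\<in>edges T. sign T d \<in> {1, -1}"
    using T by (simp_all add: is_T_def)
  have fin: "finite (verts G)" "finite (edges G)" using wf by (simp_all add: wf_graph_def)
  have "\<exists>x\<in>verts T. \<exists>y\<in>verts T. ends T d = {x, y}" if "d \<in> edges T" for d
    using ends that unfolding E by (cases d) blast
  thus ?thesis unfolding wf_graph_def using sg fin by (simp add: E V)
qed

text \<open>Stated for the part of the path from position \<open>i\<close> on, so that induction on
  decreasing \<open>i\<close> prepends one edge at a time.\<close>

lemma walk_subdivision:
  assumes T: "is_T m G T" and e: "e \<in> edges G" and uv: "v \<in> verts G"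
    and en: "\<forall>i<m. ends T (e, i) = {path_vertex m e u v i, path_vertex m e u v (Suc i)}"
    and i: "i \<le> m" "m > 0"
  shows "walk T (path_vertex m e u v i) (map (Pair e) [i..<m]) (Inl v)"
  using i(1)
proof (induction rule: inc_induct)
  case base
  have "Inl v \<in> verts T" using uv T by (auto simp: is_T_def)
  thus ?case using i(2) by (auto simp: path_vertex_def intro: walk.Nil)
next
  case (step i)
  have "(e, i) \<in> edges T" using T e step by (auto simp: is_T_def)
  with step en have "walk T (path_vertex m e u v i) ((e, i) # map (Pair e) [Suc i..<m]) (Inl v)"
    by (intro walk.Cons) auto
  thus ?case using step by (simp add: upt_conv_Cons)
qed

text \<open>Even \<open>D\<close> of absolute value at most 2k - 2 represent every even residue
  modulo 4k except 2k. Added to the offset k(1 + g) of the path, they miss only k(1 - g), the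
  increment excluded by \<open>ndvd\<close>.\<close>

lemma ex_circ_path_even_ends:
  assumes k: "k \<ge> 2" and s: "\<And>i. i < 2 * k - 2 \<Longrightarrow> s i \<in> {1, -1::int}"
    and g: "g \<in> {1, -1}" "(\<Prod>i<2 * k - 2. s i) = - g"
    and ndvd: "\<not> 4 * int k dvd 2 * b - 2 * a - int k * (1 - g)"
  shows "\<exists>\<psi>. \<psi> 0 = 2 * a \<and> \<psi> (2 * k - 2) = 2 * b \<and>
    (\<forall>i<2 * k - 2. circ_step k (s i) (\<psi> (Suc i) - \<psi> i))"
proof (rule ex_circ_path[OF s])
  \<comment> \<open>The required \<open>D\<close> is the increment minus the offset k(1 + g). Adding
    2k before and subtracting it after the reduction modulo 4k selects its representative from -2k
    up to 2k - 1; the forbidden case D = -2k is that of \<open>y\<close> divisible by 4k.\<close>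
  define y where "y = 2 * b - 2 * a - int k * (1 + g) + 2 * int k"
  let ?D = "y mod (4 * int k) - 2 * int k"
  have range: "2 \<le> r" "r \<le> 4 * int k - 2"
    if "r \<noteq> 0" "even r" "0 \<le> r" "r < 4 * int k" for r
    using that by presburger+
  have nz: "y mod (4 * int k) \<noteq> 0"
  proof
    assume "y mod (4 * int k) = 0"
    hence "4 * int k dvd y" by auto
    moreover have "4 * int k dvd y - (2 * b - 2 * a - int k * (1 - g))"
      using g(1) by (auto simp: y_def algebra_simps)
    ultimately show False using ndvd by (metis dvd_diff diff_diff_eq2 add_diff_cancel_left')
  qed
  have ev: "even (y mod (4 * int k))" using g(1) by (auto simp: y_def dvd_mod_iff)
  have "0 \<le> y mod (4 * int k)" "y mod (4 * int k) < 4 * int k" using k by auto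
  from range[OF nz ev this] show "\<bar>?D\<bar> \<le> int (2 * k - 2)" "even (?D - int (2 * k - 2))"
    using ev k by auto
  have "4 * int k dvd y - y mod (4 * int k)" by (simp add: minus_mod_eq_mult_div)
  thus "4 * int k dvd 2 * b - 2 * a - int k * (1 - (\<Prod>i<2 * k - 2. s i)) - ?D"
    unfolding g(2) by (simp add: y_def algebra_simps)
qed (use k in simp_all)

lemma X_colorable_iff_circ_map:
  assumes k: "k \<ge> 2" and wf: "wf_graph G" and T: "is_T (2 * k - 2) G T"
  shows "X_colorable k G \<longleftrightarrow> (\<exists>\<phi>. circ_map k T \<phi>)"
proof
  let ?m = "2 * k - 2"
  have k0: "k > 0" using k by simp
  have m: "?m > 0" "int ?m = 2 * int k - 2" using k by auto
  have sT: "sign T (e, i) \<in> {1, -1}" if "e \<in> edges G" "i < ?m" for e i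
    using T that by (auto simp: is_T_def)
  have pT: "(\<Prod>i<?m. sign T (e, i)) = - sign G e" if "e \<in> edges G" for e
    using T that unfolding is_T_def by blast
  {
    assume "X_colorable k G"
    then obtain \<iota> where \<iota>: "\<And>e u v. e \<in> edges G \<Longrightarrow> ends G e = {u, v} \<Longrightarrow>
      \<not> 4 * int k dvd 2 * \<iota> u - 2 * \<iota> v - int k * (1 - sign G e)"
      unfolding X_colorable_iff[OF k0 wf] by blast
    show "\<exists>\<phi>. circ_map k T \<phi>"
    proof (rule circ_map_subdivision[OF T m(1), where \<phi> = "\<lambda>v. 2 * \<iota> v"])
      fix e u v assume e: "e \<in> edges G" "ends G e = {u, v}"
      define g where "g = sign G e"
      have g: "g \<in> {1, -1}" using wf e by (auto simp: wf_graph_def g_def)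
      have "\<not> 4 * int k dvd 2 * \<iota> v - 2 * \<iota> u - int k * (1 - g)"
        using \<iota>[of e v u] e by (auto simp: g_def insert_commute)
      from ex_circ_path_even_ends[OF k sT[OF e(1)] g pT[OF e(1), folded g_def] this]
      show "\<exists>\<psi>. \<psi> 0 = 2 * \<iota> u \<and> \<psi> ?m = 2 * \<iota> v \<and> (\<forall>i<?m. (e, i) \<in> edges T \<longrightarrow>
        circ_step k (sign T (e, i)) (\<psi> (Suc i) - \<psi> i))" by blast
    qed simp_all
  next
    assume "\<exists>\<phi>. circ_map k T \<phi>"
    then obtain \<phi> where \<phi>: "circ_map k T \<phi>" by blast
    \<comment> \<open>The values at old vertices may be odd. Along an edge of \<open>G\<close> they
      differ by an even number, as the path has even length, so rounding down preserves twice the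
      difference of the halves.\<close>
    define \<iota> where "\<iota> v = \<phi> (Inl v) div 2" for v
    have "\<not> 4 * int k dvd 2 * \<iota> x - 2 * \<iota> y - int k * (1 - sign G e)"
      if e: "e \<in> edges G" and xy: "ends G e = {x, y}" for e x y
    proof -
      define g where "g = sign G e"
      have g: "g \<in> {1, -1}" using wf e by (auto simp: wf_graph_def g_def)
      obtain u v where uv: "ends G e = {u, v}"
        "\<forall>i<?m. ends T (e, i) = {path_vertex ?m e u v i, path_vertex ?m e u v (Suc i)}"
        by (rule subdivision_ends[OF T e])
      have v: "v \<in> verts G" using wf e uv(1) unfolding wf_graph_def by (metis doubleton_eq_iff)
      have w: "walk T (Inl u) (map (Pair e) [0..<?m]) (Inl v)"
        using walk_subdivision[OF T e v uv(2) _ m(1), of 0] by (simp add: path_vertex_def)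
      have sg: "\<forall>d\<in>edges T. sign T d \<in> {1, -1}" using T unfolding is_T_def by blast
      have pl: "prod_list (map (sign T) (map (Pair e) [0..<?m])) = - g"
        using pT[OF e] prod.distinct_set_conv_list[of "[0..<?m]" "\<lambda>i. sign T (e, i)"]
        by (simp add: g_def comp_def atLeast0LessThan)
      obtain D where D: "\<bar>D\<bar> \<le> 2 * int k - 2" "even D"
        "4 * int k dvd \<phi> (Inl v) - \<phi> (Inl u) - int k * (1 + g) - D"
        using walk_displacement[OF sg \<phi> w] unfolding pl by (auto simp: m(2))
      let ?z = "\<phi> (Inl v) - \<phi> (Inl u)"
      have "even (?z - int k * (1 + g) - D)" by (rule dvd_trans[OF _ D(3)]) simp
      hence evz: "even ?z" using D(2) g by auto
      have "2 * (a div 2) - 2 * (b div 2) = a - b" if "even (a - b)" for a b :: int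
        using that by presburger
      from this[OF evz] have z: "2 * \<iota> v - 2 * \<iota> u = ?z" by (simp only: \<iota>_def)
      \<comment> \<open>The forbidden increment would make 4k divide
        \<open>D + 2 * int k * g\<close>, which has absolute value between 2 and 4k - 2.\<close>
      have nz: "\<not> 4 * int k dvd ?z - int k * (1 - g)"
      proof
        assume "4 * int k dvd ?z - int k * (1 - g)"
        from dvd_diff[OF this D(3)] have "4 * int k dvd D + 2 * int k * g" by (simp add: algebra_simps)
        moreover have "D + 2 * int k * g \<noteq> 0" "\<bar>D + 2 * int k * g\<bar> < 4 * int k" using D(1) g by auto
        ultimately show False using dvd_imp_le_int[of "D + 2 * int k * g" "4 * int k"] by linarith
      qed
      have "x = u \<and> y = v \<or> x = v \<and> y = u" using xy uv(1) by (auto simp: doubleton_eq_iff)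
      thus ?thesis
      proof
        assume "x = v \<and> y = u"
        thus ?thesis using nz z by (simp add: g_def)
      next
        assume xy: "x = u \<and> y = v"
        show ?thesis
        proof
          assume "4 * int k dvd 2 * \<iota> x - 2 * \<iota> y - int k * (1 - sign G e)"
          moreover have "2 * \<iota> x - 2 * \<iota> y - int k * (1 - sign G e) = - (?z + int k * (1 - g))"
            using xy z by (simp add: g_def)
          ultimately have "4 * int k dvd - (?z + int k * (1 - g))" by (simp only:)
          hence "4 * int k dvd ?z + int k * (1 - g)" by (simp only: dvd_minus_iff)
          \<comment> \<open>The forbidden residue k(1 - g) is its own negative, so the orientation
            of the edge is immaterial.\<close>
          moreover have "4 * int k dvd 2 * int k * (1 - g)" using g by auto
          ultimately have "4 * int k dvd ?z + int k * (1 - g) - 2 * int k * (1 - g)" by (rule dvd_diff)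
          thus False using nz by (simp add: algebra_simps)
        qed
      qed
    qed
    thus "X_colorable k G" unfolding X_colorable_iff[OF k0 wf] by blast
  }
qed

section \<open>Homomorphisms to the negative cycle as lifts to its double cover\<close>

lemma prod_sign_edges:
  assumes "wf_graph C"
  shows "(\<Prod>e\<in>edges C. sign C e) = (-1) ^ card {e \<in> edges C. sign C e = -1}"
proof -
  have "(\<Prod>e\<in>edges C. sign C e) = (\<Prod>e\<in>{e \<in> edges C. sign C e = -1}. -1)"
    using assms by (intro prod.mono_neutral_cong_right) (auto simp: wf_graph_def)
  thus ?thesis by simp
qed

lemma switched_sign_doubleton:
  assumes "ends G e = {u, v}"
  shows "switched_sign G X e = (if u \<in> X \<longleftrightarrow> v \<in> X then sign G e else - sign G e)"
  using assms by (auto simp: switched_sign_def doubleton_eq_iff)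

text \<open>A position on the cycle together with a bit for switching amounts to a residue modulo
  4k. Reduction modulo 2k returns the position, and the bit tells the two residues above it
  apart.\<close>

lemma sg_hom_iff_circ_map:
  assumes k: "k > 0" and C: "is_negative_cycle (2 * k) C" and wf: "wf_graph G"
  shows "sg_hom G C \<longleftrightarrow> (\<exists>\<phi>. circ_map k G \<phi>)"
proof
  obtain p d where p: "bij_betw p {..<2 * k} (verts C)" and d: "bij_betw d {..<2 * k} (edges C)"
    and en: "\<And>i. i < 2 * k \<Longrightarrow> ends C (d i) = {p i, p (Suc i mod (2 * k))}"
    using C unfolding is_negative_cycle_def by blast
  have wfC: "wf_graph C" and oddC: "odd (card {e \<in> edges C. sign C e = -1})"
    using C unfolding is_negative_cycle_def by blast+
  define s where "s i = sign C (d i)" for i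
  have dE: "d i \<in> edges C" if "i < 2 * k" for i using d that by (auto simp: bij_betw_def)
  have s: "s i \<in> {1, -1}" if "i < 2 * k" for i
    using dE[OF that] wfC by (auto simp: wf_graph_def s_def)
  have P: "(\<Prod>i<2 * k. s i) = -1"
    using prod.reindex_bij_betw[OF d, of "sign C"] prod_sign_edges[OF wfC] oddC by (simp add: s_def)
  \<comment> \<open>\<open>\<theta>\<close> unrolls the cycle in its double cover, the cycle of length \<open>4k\<close> in which
    switching a vertex is the shift by \<open>2k\<close>.\<close>
  define \<theta> where "\<theta> j = int j + int k * (1 - (\<Prod>i<j. s i))" for j
  \<comment> \<open>Advancing by one edge adds 1 and the offset of its sign. After a full turn the
    length 2k and the offset 2k of the negative product sum to 4k, so the closing edge obeys the
    same rule.\<close>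
  have \<theta>_step: "4 * int k dvd \<theta> (Suc j mod (2 * k)) - \<theta> j - int k * (1 - s j) - 1" if "j < 2 * k" for j
  proof -
    have Pj: "(\<Prod>i<j. s i) \<in> {1, -1}" using s that by (intro prod_signs) auto
    note off = sign_offset_add[OF Pj s[OF that], of k]
    show ?thesis
    proof (cases "Suc j = 2 * k")
      case False
      hence "Suc j mod (2 * k) = Suc j" using that by simp
      thus ?thesis using off by (simp add: \<theta>_def algebra_simps)
    next
      case True
      have "(\<Prod>i<j. s i) * s j = -1" using P unfolding True[symmetric] by simp
      hence "4 * int k dvd int k * 2 - int k * (1 - (\<Prod>i<j. s i)) - int k * (1 - s j) - 4 * int k"
        using dvd_diff[OF off dvd_refl] by simp
      moreover have "int j = 2 * int k - 1" using True by linarith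
      hence "\<theta> j = 2 * int k - 1 + int k * (1 - (\<Prod>i<j. s i))" "\<theta> (Suc j mod (2 * k)) = 0"
        using True by (simp_all add: \<theta>_def)
      hence "\<theta> (Suc j mod (2 * k)) - \<theta> j - int k * (1 - s j) - 1
          = int k * 2 - int k * (1 - (\<Prod>i<j. s i)) - int k * (1 - s j) - 4 * int k"
        by linarith
      ultimately show ?thesis by (simp only:)
    qed
  qed
  {
    assume "sg_hom G C"
    then obtain X f where f: "f ` verts G \<subseteq> verts C"
      and hom: "\<And>e u v. e \<in> edges G \<Longrightarrow> ends G e = {u, v} \<Longrightarrow>
        \<exists>c\<in>edges C. ends C c = {f u, f v} \<and> sign C c = switched_sign G X e"
      unfolding sg_hom_def switching_equivalent_def by metis
    have "verts C = p ` {..<2 * k}" using p by (simp add: bij_betw_def)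
    hence "\<forall>v\<in>verts G. \<exists>q<2 * k. f v = p q" using f by blast
    then obtain q where q: "\<And>v. v \<in> verts G \<Longrightarrow> q v < 2 * k \<and> f v = p (q v)" by metis
    define \<phi> where "\<phi> v = \<theta> (q v) + (if v \<in> X then 2 * int k else 0)" for v
    \<comment> \<open>Only edges mapped in the forward direction of the cycle are treated here; the
      others follow by exchanging the ends.\<close>
    have fwd: "circ_step k (sign G e) (\<phi> v - \<phi> u)"
      if e: "e \<in> edges G" "ends G e = {u, v}" and "q u < 2 * k" "q v = Suc (q u) mod (2 * k)"
        "s (q u) = switched_sign G X e" for e u v
    proof -
      \<comment> \<open>The discrepancy consists of the switching shifts at the two ends and the
        difference of the offsets of target and source signs. Both are 2k modulo 4k exactly when one
        end lies in \<open>X\<close>, so they cancel.\<close>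
      define c where "c = \<phi> v - \<phi> u - (\<theta> (q v) - \<theta> (q u)) + int k * (1 - s (q u)) - int k * (1 - sign G e)"
      have "sign G e \<in> {1, -1}" using wf e(1) by (auto simp: wf_graph_def)
      hence "4 * int k dvd c"
        unfolding c_def that(5) switched_sign_doubleton[OF e(2)] \<phi>_def by (auto split: if_splits)
      from dvd_add[OF this \<theta>_step[OF that(3)]] have "4 * int k dvd \<phi> v - \<phi> u - int k * (1 - sign G e) - 1"
        by (simp add: c_def that(4) algebra_simps)
      thus ?thesis by (auto simp: circ_step_def)
    qed
    have "circ_step k (sign G e) (\<phi> v - \<phi> u)" if e: "e \<in> edges G" "ends G e = {u, v}" for e u v
    proof -
      have uv: "u \<in> verts G" "v \<in> verts G"
        using wf e unfolding wf_graph_def by (metis doubleton_eq_iff)+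
      have sg: "sign G e \<in> {1, -1}" using wf e(1) by (auto simp: wf_graph_def)
      obtain c where c: "c \<in> edges C" "ends C c = {f u, f v}" "sign C c = switched_sign G X e"
        using hom[OF e] by blast
      then obtain i where i: "i < 2 * k" "c = d i" using d by (auto simp: bij_betw_def)
      have i': "Suc i mod (2 * k) < 2 * k" using k by simp
      have "{p i, p (Suc i mod (2 * k))} = {p (q u), p (q v)}"
        using c(2) en[OF i(1)] i(2) q uv by simp
      hence "p i = p (q u) \<and> p (Suc i mod (2 * k)) = p (q v) \<or> p i = p (q v) \<and> p (Suc i mod (2 * k)) = p (q u)"
        by (auto simp: doubleton_eq_iff)
      hence "i = q u \<and> Suc i mod (2 * k) = q v \<or> i = q v \<and> Suc i mod (2 * k) = q u"
        using p i(1) i' q uv unfolding bij_betw_def inj_on_def by (metis lessThan_iff)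
      thus ?thesis
      proof
        assume "i = q u \<and> Suc i mod (2 * k) = q v"
        hence "q u < 2 * k" "q v = Suc (q u) mod (2 * k)" "s (q u) = switched_sign G X e"
          using c(3) i by (auto simp: s_def)
        thus ?thesis by (rule fwd[OF e])
      next
        assume "i = q v \<and> Suc i mod (2 * k) = q u"
        hence q': "q v < 2 * k" "q u = Suc (q v) mod (2 * k)" "s (q v) = switched_sign G X e"
          using c(3) i by (auto simp: s_def)
        have "ends G e = {v, u}" using e(2) by auto
        from fwd[OF e(1) this q'] have "circ_step k (sign G e) (\<phi> u - \<phi> v)" .
        from circ_step_uminus[OF sg this] show ?thesis by simp
      qed
    qed
    thus "\<exists>\<phi>. circ_map k G \<phi>" unfolding circ_map_def by blast
  next
    assume "\<exists>\<phi>. circ_map k G \<phi>"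
    then obtain \<phi> where \<phi>: "circ_map k G \<phi>" by blast
    define q where "q v = nat (\<phi> v mod (2 * int k))" for v
    have q: "q v < 2 * k" "int (q v) = \<phi> v mod (2 * int k)" for v
    proof -
      have "0 \<le> \<phi> v mod (2 * int k)" "\<phi> v mod (2 * int k) < 2 * int k" using k by simp_all
      thus "q v < 2 * k" "int (q v) = \<phi> v mod (2 * int k)" unfolding q_def by linarith+
    qed
    \<comment> \<open>These are the vertices on the other sheet of the double cover:
      \<open>\<phi> v\<close> and \<open>\<theta> (q v)\<close> agree modulo 2k but differ by 2k
      modulo 4k.\<close>
    define X where "X = {v \<in> verts G. \<not> 4 * int k dvd \<phi> v - \<theta> (q v)}"
    define h where "h v = (if v \<in> X then 2 * int k else 0)" for v
    have lift: "4 * int k dvd \<phi> v - \<theta> (q v) - h v" if v: "v \<in> verts G" for v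
    proof (cases "v \<in> X")
      case True
      have "(\<Prod>i<q v. s i) \<in> {1, -1}" using s q(1)[of v] by (intro prod_signs) auto
      hence "2 * int k dvd int k * (1 - (\<Prod>i<q v. s i))" by auto
      moreover have "2 * int k dvd \<phi> v - int (q v)" by (simp add: q(2) minus_mod_eq_mult_div)
      ultimately have "2 * int k dvd \<phi> v - int (q v) - int k * (1 - (\<Prod>i<q v. s i))"
        by (rule dvd_diff[rotated])
      hence "2 * int k dvd \<phi> v - \<theta> (q v)" by (simp only: \<theta>_def diff_diff_add)
      then obtain t where t: "\<phi> v - \<theta> (q v) = 2 * int k * t" by (rule dvdE)
      have "odd t"
      proof
        assume "even t"
        hence "4 * int k dvd \<phi> v - \<theta> (q v)" unfolding t by (auto elim!: evenE)
        thus False using True by (simp add: X_def)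
      qed
      then obtain t' where "t = 2 * t' + 1" by (rule oddE)
      hence "\<phi> v - \<theta> (q v) - h v = 4 * int k * t'" using t True by (simp add: h_def algebra_simps)
      thus ?thesis by simp
    qed (use v in \<open>auto simp: X_def h_def\<close>)
    have fwd: "ends C (d (q u)) = {p (q u), p (q v)} \<and> s (q u) = switched_sign G X e"
      if e: "e \<in> edges G" "ends G e = {u, v}"
        and r: "4 * int k dvd \<phi> v - \<phi> u - int k * (1 - sign G e) - 1" for e u v
    proof -
      have uv: "u \<in> verts G" "v \<in> verts G"
        using wf e unfolding wf_graph_def by (metis doubleton_eq_iff)+
      have sg: "sign G e \<in> {1, -1}" using wf e(1) by (auto simp: wf_graph_def)
      have "2 * int k dvd \<phi> v - \<phi> u - int k * (1 - sign G e) - 1" by (rule dvd_trans[OF _ r]) simp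
      moreover have "2 * int k dvd int k * (1 - sign G e)" using sg by auto
      ultimately have "2 * int k dvd \<phi> v - \<phi> u - int k * (1 - sign G e) - 1 + int k * (1 - sign G e)"
        by (rule dvd_add)
      hence "2 * int k dvd \<phi> v - (\<phi> u + 1)" by (simp add: algebra_simps)
      hence "\<phi> v mod (2 * int k) = (\<phi> u mod (2 * int k) + 1) mod (2 * int k)"
        by (simp add: mod_eq_dvd_iff mod_add_left_eq)
      hence "int (q v) = int (Suc (q u) mod (2 * k))"
        by (simp add: q(2) zmod_int add.commute)
      hence qv: "q v = Suc (q u) mod (2 * k)" by linarith
      \<comment> \<open>In this combination all values of \<open>\<phi>\<close> and
        \<open>\<theta>\<close> cancel, leaving switching shifts against sign offsets: the two signs
        differ exactly when one end is switched.\<close>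
      from dvd_add[OF dvd_diff[OF dvd_diff[OF lift[OF uv(2)] lift[OF uv(1)]] r]
          \<theta>_step[OF q(1)[of u], folded qv]]
      have "4 * int k dvd h u - h v + int k * (1 - sign G e) - int k * (1 - s (q u))"
        by (simp add: algebra_simps)
      moreover have "\<not> 4 * int k dvd 2 * int k" "\<not> 4 * int k dvd - (2 * int k)"
        using k zdvd_not_zless[of "2 * int k" "4 * int k"] by (simp_all only: dvd_minus_iff) simp_all
      ultimately have "s (q u) = switched_sign G X e"
        using sg s[OF q(1)[of u]] unfolding switched_sign_doubleton[OF e(2)] h_def
        by (auto simp: algebra_simps split: if_splits)
      thus ?thesis using en[OF q(1)[of u]] qv by simp
    qed
    have "\<exists>c\<in>edges C. ends C c = {p (q u), p (q v)} \<and> sign C c = switched_sign G X e"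
      if e: "e \<in> edges G" "ends G e = {u, v}" for e u v
    proof -
      have "circ_step k (sign G e) (\<phi> v - \<phi> u)" using \<phi> e unfolding circ_map_def by blast
      then consider "4 * int k dvd \<phi> v - \<phi> u - int k * (1 - sign G e) - 1"
        | "4 * int k dvd \<phi> v - \<phi> u - int k * (1 - sign G e) - (-1)"
        unfolding circ_step_def by blast
      thus ?thesis
      proof cases
        case 1
        from fwd[OF e this] show ?thesis using dE[OF q(1)] by (auto simp: s_def)
      next
        case 2
        have "sign G e \<in> {1, -1}" using wf e(1) by (auto simp: wf_graph_def)
        \<comment> \<open>Read from \<open>v\<close> to \<open>u\<close>, a step with
          \<open>r = -1\<close> becomes one with \<open>r = 1\<close>.\<close>
        hence "4 * int k dvd - (2 * int k * (1 - sign G e))" by auto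
        from dvd_diff[OF this 2] have "4 * int k dvd \<phi> u - \<phi> v - int k * (1 - sign G e) - 1"
          by (simp add: algebra_simps)
        moreover have "ends G e = {v, u}" using e(2) by auto
        ultimately show ?thesis using fwd[of e v u] e(1) dE[OF q(1)] by (auto simp: s_def)
      qed
    qed
    moreover have "(\<lambda>v. p (q v)) ` verts G \<subseteq> verts C" using p q(1) by (auto simp: bij_betw_def)
    moreover have "switching_equivalent G (switched_sign G X)"
      unfolding switching_equivalent_def by (intro exI[of _ X]) (auto simp: X_def)
    ultimately show "sg_hom G C" unfolding sg_hom_def
      by (intro exI[of _ "switched_sign G X"] exI[of _ "\<lambda>v. p (q v)"]) blast
  }
qed

section \<open>Closed walks in the cycle and in the subdivision\<close>

lemma of_nat_bit_eq: "(of_nat n :: bit) = (if even n then 0 else 1)"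
  by (induction n) auto

lemma gij_mono:
  assumes "\<And>u es. walk T u es u \<Longrightarrow> es \<noteq> [] \<Longrightarrow> of_nat (length (filter (\<lambda>e. sign T e = -1) es)) = i \<Longrightarrow>
      of_nat (length es) = j \<Longrightarrow> \<exists>v ds. walk C v ds v \<and> ds \<noteq> [] \<and>
        of_nat (length (filter (\<lambda>e. sign C e = -1) ds)) = i \<and> of_nat (length ds) = j \<and>
        length ds \<le> length es"
  shows "gij i j C \<le> gij i j T"
  unfolding gij_def
proof (rule Inf_greatest)
  fix n assume "n \<in> {enat (length es) |es. es \<noteq> [] \<and> (\<exists>u. walk T u es u) \<and>
    of_nat (length (filter (\<lambda>e. sign T e = - 1) es)) = i \<and> of_nat (length es) = j}"
  then obtain es u where es: "n = enat (length es)" "es \<noteq> []" "walk T u es u"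
    "of_nat (length (filter (\<lambda>e. sign T e = - 1) es)) = i" "of_nat (length es) = j" by blast
  from assms[OF es(3,2,4,5)] obtain v ds where ds: "walk C v ds v" "ds \<noteq> []"
    "of_nat (length (filter (\<lambda>e. sign C e = -1) ds)) = i" "of_nat (length ds) = j"
    "length ds \<le> length es" by blast
  show "Inf {enat (length es) |es. es \<noteq> [] \<and> (\<exists>u. walk C u es u) \<and>
    of_nat (length (filter (\<lambda>e. sign C e = - 1) es)) = i \<and> of_nat (length es) = j} \<le> n"
    by (rule Inf_lower2[of "enat (length ds)"]) (use ds es(1) in auto)
qed

text \<open>Going back and forth on one edge bounds \<open>gij 0 0 C\<close> by 2, and going once
  around bounds \<open>gij 1 0 C\<close> by 2k.\<close>

lemma negative_cycle_walks:
  assumes k: "k > 0" and C: "is_negative_cycle (2 * k) C"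
  obtains u c es where "walk C u [c, c] u" "walk C u es u" "length es = 2 * k"
    "odd (length (filter (\<lambda>e. sign C e = -1) es))"
proof -
  obtain p d where p: "bij_betw p {..<2 * k} (verts C)" and d: "bij_betw d {..<2 * k} (edges C)"
    and en: "\<And>i. i < 2 * k \<Longrightarrow> ends C (d i) = {p i, p (Suc i mod (2 * k))}"
    using C unfolding is_negative_cycle_def by blast
  have dE: "d i \<in> edges C" if "i < 2 * k" for i using d that by (auto simp: bij_betw_def)
  have p0: "p 0 \<in> verts C" using p k by (auto simp: bij_betw_def)
  \<comment> \<open>The index is reduced modulo 2k so that the walk starting at i = 2k is the empty
    one at \<open>p 0\<close>.\<close>
  have "walk C (p (i mod (2 * k))) (map d [i..<2 * k]) (p 0)" if "i \<le> 2 * k" for i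
    using that
  proof (induction rule: inc_induct)
    case base
    show ?case using p0 by (simp add: walk.Nil)
  next
    case (step i)
    have "walk C (p i) (d i # map d [Suc i..<2 * k]) (p 0)"
      by (rule walk.Cons[OF dE en step.IH]) (use step in auto)
    thus ?case using step by (simp add: upt_conv_Cons)
  qed
  from this[of 0] have around: "walk C (p 0) (map d [0..<2 * k]) (p 0)" by simp
  let ?c = "d 0"
  have c: "?c \<in> edges C" "ends C ?c = {p 0, p (Suc 0 mod (2 * k))}"
    using dE[of 0] en[of 0] k by auto
  have "ends C ?c = {p (Suc 0 mod (2 * k)), p 0}" unfolding c(2) by (rule insert_commute)
  from walk.Cons[OF c walk.Cons[OF c(1) this walk.Nil[OF p0]]]
  have bothways: "walk C (p 0) [?c, ?c] (p 0)" .
  have "distinct (filter (\<lambda>e. sign C e = -1) (map d [0..<2 * k]))"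
    using d by (intro distinct_filter) (auto simp: distinct_map bij_betw_def atLeast0LessThan)
  moreover have "set (filter (\<lambda>e. sign C e = -1) (map d [0..<2 * k])) = {e \<in> edges C. sign C e = -1}"
    using d by (auto simp: bij_betw_def atLeast0LessThan)
  ultimately have "length (filter (\<lambda>e. sign C e = -1) (map d [0..<2 * k])) = card {e \<in> edges C. sign C e = -1}"
    by (metis distinct_card)
  moreover have "odd (card {e \<in> edges C. sign C e = -1})"
    using C unfolding is_negative_cycle_def by blast
  ultimately have "odd (length (filter (\<lambda>e. sign C e = -1) (map d [0..<2 * k])))" by metis
  moreover have "length (map d [0..<2 * k]) = 2 * k" by simp
  ultimately show ?thesis by (intro that[OF bothways around])
qed

text \<open>Paths of even length make \<open>T\<close> bipartite: the classes are given by the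
  parity of the position on a path, both ends being even.\<close>

lemma walk_subdivision_parity:
  assumes T: "is_T m G T" and m: "even m" and w: "walk T x es y"
  defines "par \<equiv> case_sum (\<lambda>_. 0) snd"
  shows "even (par x + par y + length es)"
  using w
proof (induction rule: walk.induct)
  case (Cons d x y es z)
  obtain e i where ei: "d = (e, i)" "e \<in> edges G" "i < m"
    using Cons.hyps(1) T by (auto simp: is_T_def)
  obtain u v where uv: "\<forall>i<m. ends T (e, i) = {path_vertex m e u v i, path_vertex m e u v (Suc i)}"
    by (rule subdivision_ends[OF T ei(2)])
  have par: "even (par (path_vertex m e u v j)) = even j" for j
    using m by (auto simp: path_vertex_def par_def)
  have "{x, y} = {path_vertex m e u v i, path_vertex m e u v (Suc i)}"
    using uv[rule_format, OF ei(3)] Cons.hyps(2) unfolding ei(1) by simp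
  hence "x = path_vertex m e u v i \<and> y = path_vertex m e u v (Suc i) \<or>
      x = path_vertex m e u v (Suc i) \<and> y = path_vertex m e u v i"
    by (simp only: doubleton_eq_iff)
  hence "even (par x) \<noteq> even (par y)" using par[of i] par[of "Suc i"] by (elim disjE) simp_all
  thus ?case using Cons.IH by auto
qed simp

lemma walk_restrict_edges:
  "walk G u es w \<Longrightarrow> set es \<subseteq> F \<Longrightarrow> walk (G\<lparr>edges := F\<rparr>) u es w"
proof (induction rule: walk.induct)
  case (Cons e u v es w)
  have "e \<in> edges (G\<lparr>edges := F\<rparr>)" "ends (G\<lparr>edges := F\<rparr>) e = {u, v}"
    using Cons by simp_all
  thus ?case by (rule walk.Cons) (use Cons in simp)
qed (simp add: walk.Nil)

section \<open>Transfer of criticality\<close>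

text \<open>A single edge prevents a coloring only if it is a positive loop, and then criticality
  leaves no room for further vertices.\<close>

lemma card_edges_X_critical:
  assumes k: "k \<ge> 2" and wf: "wf_graph G" and crit: "X_critical k G"
    and loop: "\<not> single_positive_loop G"
  shows "card (edges G) \<ge> 2"
proof (rule ccontr)
  assume "\<not> card (edges G) \<ge> 2"
  have k0: "k > 0" using k by simp
  have nc: "\<not> X_colorable k G" using crit by (simp add: X_critical_def)
  have "finite (edges G)" using wf by (simp add: wf_graph_def)
  moreover have "edges G \<noteq> {}" using nc unfolding X_colorable_iff[OF k0 wf] by auto
  ultimately have "card (edges G) = 1" using \<open>\<not> card (edges G) \<ge> 2\<close> by (metis One_nat_def card_0_eq less_2_cases not_le)
  then obtain e where e: "edges G = {e}" by (rule card_1_singletonE)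
  obtain u v where uv: "ends G e = {u, v}" "u \<in> verts G" "v \<in> verts G"
    using wf e by (auto simp: wf_graph_def)
  have sg: "sign G e \<in> {1, -1}" using wf e by (auto simp: wf_graph_def)
  have small: "\<not> 4 * int k dvd x" if "x \<noteq> 0" "\<bar>x\<bar> < 4 * int k" for x
    using that dvd_imp_le_int[of x "4 * int k"] by auto
  show False
  proof (cases "u = v")
    case False
    \<comment> \<open>The doubled indices differ by 2 in absolute value, which for k at least 2 is
      neither 0 nor 2k modulo 4k.\<close>
    define \<iota> where "\<iota> w = (if w = u then 1 else 0 :: int)" for w
    have "\<not> 4 * int k dvd 2 * \<iota> x - 2 * \<iota> y - int k * (1 - sign G e)" if "ends G e = {x, y}" for x y
    proof (rule small)
      have "x = u \<and> y = v \<or> x = v \<and> y = u" using that uv(1) by (auto simp: doubleton_eq_iff)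
      thus "2 * \<iota> x - 2 * \<iota> y - int k * (1 - sign G e) \<noteq> 0"
        "\<bar>2 * \<iota> x - 2 * \<iota> y - int k * (1 - sign G e)\<bar> < 4 * int k"
        using False sg k by (auto simp: \<iota>_def)
    qed
    hence "X_colorable k G" unfolding X_colorable_iff[OF k0 wf] e by blast
    thus False using nc by blast
  next
    case True
    show False
    proof (cases "sign G e = 1")
      case False
      hence "sign G e = -1" using sg by auto
      hence "X_colorable k G" unfolding X_colorable_iff[OF k0 wf] e
        using small[of "- 2 * int k"] k by (intro exI[of _ "\<lambda>_. 0"]) auto
      thus False using nc by blast
    next
      case pos: True
      let ?S = "G\<lparr>verts := {u}\<rparr>"
      have S: "wf_graph ?S" using wf e uv True by (auto simp: wf_graph_def)
      have "verts G \<noteq> {u}" using loop e uv True pos unfolding single_positive_loop_def by auto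
      hence "proper_subgraph ?S G" using S uv unfolding proper_subgraph_def by auto
      hence "X_colorable k ?S" using crit by (simp add: X_critical_def)
      hence "X_colorable k G" using X_colorable_cong_edges[OF k0 wf S] by simp
      thus False using nc by blast
    qed
  qed
qed

text \<open>If an edge of some path is missing, a coloring of \<open>G\<close> without the
  subdivided edge extends over the broken path. If only vertices are missing, \<open>G\<close> has
  an isolated vertex, contrary to criticality.\<close>

lemma X_critical_imp_circ_map_subgraph:
  assumes k: "k \<ge> 2" and wf: "wf_graph G" and T: "is_T (2 * k - 2) G T"
    and crit: "X_critical k G" and S: "proper_subgraph S T"
  shows "\<exists>\<phi>. circ_map k S \<phi>"
proof -
  let ?m = "2 * k - 2"
  have k0: "k > 0" and m: "?m > 0" using k by simp_all
  have wfS: "wf_graph S" and sub: "verts S \<subseteq> verts T" "edges S \<subseteq> edges T"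
    "\<forall>d\<in>edges S. ends S d = ends T d \<and> sign S d = sign T d"
    and proper: "verts S \<noteq> verts T \<or> edges S \<noteq> edges T"
    using S unfolding proper_subgraph_def by blast+
  have ET: "edges T = edges G \<times> {..<?m}"
    and VT: "verts T = Inl ` verts G \<union> Inr ` (edges G \<times> {0<..<?m})"
    using T by (simp_all add: is_T_def)
  have sT: "sign T (e, i) \<in> {1, -1}" if "e \<in> edges G" "i < ?m" for e i
    using T that by (auto simp: is_T_def)
  have pT: "(\<Prod>i<?m. sign T (e, i)) = - sign G e" if "e \<in> edges G" for e
    using T that by (simp add: is_T_def)
  show ?thesis
  proof (cases "edges S = edges T")
    case True
    have pv: "path_vertex ?m e u v i \<in> verts S \<and> path_vertex ?m e u v (Suc i) \<in> verts S"
      if "e \<in> edges G" "i < ?m" "\<forall>i<?m. ends T (e, i) = {path_vertex ?m e u v i, path_vertex ?m e u v (Suc i)}"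
      for e u v i
    proof -
      have "(e, i) \<in> edges S" using that True ET by simp
      hence "\<exists>x\<in>verts S. \<exists>y\<in>verts S. ends S (e, i) = {x, y}" "ends S (e, i) = ends T (e, i)"
        using wfS sub(3) by (auto simp: wf_graph_def)
      thus ?thesis using that by (auto simp: doubleton_eq_iff)
    qed
    obtain x where x: "x \<in> verts T" "x \<notin> verts S" using proper True sub(1) by blast
    \<comment> \<open>All edges are present in \<open>S\<close>, hence so are their ends; a missing
      vertex must be an old one that lies on no edge.\<close>
    have inner: "x \<noteq> Inr (e, i)" if ei: "e \<in> edges G" "0 < i" "i < ?m" for e i
    proof -
      obtain u v where uv: "\<forall>i<?m. ends T (e, i) = {path_vertex ?m e u v i, path_vertex ?m e u v (Suc i)}"
        by (rule subdivision_ends[OF T ei(1)])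
      show ?thesis using pv[OF ei(1,3) uv] x(2) ei by (auto simp: path_vertex_def)
    qed
    have "x \<notin> Inr ` (edges G \<times> {0<..<?m})"
    proof
      assume "x \<in> Inr ` (edges G \<times> {0<..<?m})"
      then obtain e i where "x = Inr (e, i)" "e \<in> edges G" "i \<in> {0<..<?m}" by blast
      thus False using inner[of e i] by simp
    qed
    then obtain w where w: "x = Inl w" "w \<in> verts G" using x(1) unfolding VT by blast
    have isolated: "w \<notin> ends G e" if e: "e \<in> edges G" for e
    proof -
      obtain u v where uv: "ends G e = {u, v}"
        "\<forall>i<?m. ends T (e, i) = {path_vertex ?m e u v i, path_vertex ?m e u v (Suc i)}"
        by (rule subdivision_ends[OF T e])
      have "Inl u \<in> verts S" using pv[OF e m uv(2)] by (simp add: path_vertex_def)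
      moreover have "Inl v \<in> verts S"
      proof -
        have last: "?m - 1 < ?m" "Suc (?m - 1) = ?m" using m by simp_all
        from pv[OF e last(1) uv(2)] have "path_vertex ?m e u v ?m \<in> verts S" unfolding last(2) by blast
        thus ?thesis using m by (simp add: path_vertex_def)
      qed
      ultimately show ?thesis using x(2) w(1) uv(1) by auto
    qed
    let ?R = "G\<lparr>verts := verts G - {w}\<rparr>"
    have "\<exists>u\<in>verts G - {w}. \<exists>v\<in>verts G - {w}. ends G e = {u, v}" if e: "e \<in> edges G" for e
    proof -
      obtain u v where "ends G e = {u, v}" "u \<in> verts G" "v \<in> verts G"
        using wf e unfolding wf_graph_def by metis
      thus ?thesis using isolated[OF e] by auto
    qed
    hence R: "wf_graph ?R" using wf by (auto simp: wf_graph_def)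
    hence "proper_subgraph ?R G" using w(2) unfolding proper_subgraph_def by auto
    hence "X_colorable k ?R" using crit by (simp add: X_critical_def)
    hence "X_colorable k G" using X_colorable_cong_edges[OF k0 wf R] by simp
    thus ?thesis using crit by (simp add: X_critical_def)
  next
    case False
    then obtain e\<^sub>0 l where el: "e\<^sub>0 \<in> edges G" "l < ?m" "(e\<^sub>0, l) \<notin> edges S"
      using sub(2) ET by auto
    let ?R = "G\<lparr>edges := edges G - {e\<^sub>0}\<rparr>"
    have R: "wf_graph ?R" using wf by (auto simp: wf_graph_def)
    hence "proper_subgraph ?R G" using el(1) unfolding proper_subgraph_def by auto
    hence "X_colorable k ?R" using crit by (simp add: X_critical_def)
    hence "\<exists>\<iota>. \<forall>e\<in>edges G - {e\<^sub>0}. \<forall>u v. ends G e = {u, v} \<longrightarrow>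
        \<not> 4 * int k dvd 2 * \<iota> u - 2 * \<iota> v - int k * (1 - sign G e)"
      unfolding X_colorable_iff[OF k0 R] by simp
    then obtain \<iota> where \<iota>: "\<And>e u v. e \<in> edges G \<Longrightarrow> e \<noteq> e\<^sub>0 \<Longrightarrow> ends G e = {u, v} \<Longrightarrow>
        \<not> 4 * int k dvd 2 * \<iota> u - 2 * \<iota> v - int k * (1 - sign G e)"
      by blast
    show ?thesis
    proof (rule circ_map_subdivision[OF T m sub(2,3), where \<phi> = "\<lambda>v. 2 * \<iota> v"])
      fix e u v assume e: "e \<in> edges G" "ends G e = {u, v}"
      show "\<exists>\<psi>. \<psi> 0 = 2 * \<iota> u \<and> \<psi> ?m = 2 * \<iota> v \<and>
        (\<forall>i<?m. (e, i) \<in> edges S \<longrightarrow> circ_step k (sign T (e, i)) (\<psi> (Suc i) - \<psi> i))"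
      proof (cases "e = e\<^sub>0")
        case True
        from ex_circ_broken_path[of ?m "\<lambda>i. sign T (e, i)", OF sT[OF e(1)] el(2), where k = k and a = "2 * \<iota> u" and b = "2 * \<iota> v"]
        obtain \<psi> where \<psi>: "\<psi> 0 = 2 * \<iota> u" "\<psi> ?m = 2 * \<iota> v"
          "\<forall>i<?m. i \<noteq> l \<longrightarrow> circ_step k (sign T (e, i)) (\<psi> (Suc i) - \<psi> i)" by blast
        have "i \<noteq> l" if "(e, i) \<in> edges S" for i using el(3) that unfolding True by blast
        with \<psi> show ?thesis by blast
      next
        case False
        have g: "sign G e \<in> {1, -1}" using wf e(1) by (auto simp: wf_graph_def)
        have "ends G e = {v, u}" using e(2) by auto
        from ex_circ_path_even_ends[OF k sT[OF e(1)] g pT[OF e(1)] \<iota>[OF e(1) False this]]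
        show ?thesis by blast
      qed
    qed
  qed
qed

text \<open>Odd closed walks do not exist in \<open>T\<close>; positive ones are matched by the walk
  of length 2 in \<open>C\<close>, negative ones by the full turn.\<close>

lemma X_critical_imp_gij:
  assumes k: "k \<ge> 2" and wf: "wf_graph G" and T: "is_T (2 * k - 2) G T"
    and C: "is_negative_cycle (2 * k) C" and crit: "X_critical k G"
    and loop: "\<not> single_positive_loop G"
  shows "gij i j C \<le> gij i j T"
proof (rule gij_mono)
  let ?neg = "\<lambda>es. length (filter (\<lambda>d. sign T d = -1) es)"
  fix x es
  assume w: "walk T x es x" and ne: "es \<noteq> []"
    and i: "of_nat (?neg es) = i" and j: "of_nat (length es) = j"
  have k0: "k > 0" using k by simp
  have wfT: "wf_graph T" by (rule wf_graph_subdivision[OF wf T])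
  have "even (length es)" using walk_subdivision_parity[OF T _ w] by simp
  hence j0: "j = 0" using j by (simp add: of_nat_bit_eq)
  have "length es \<noteq> 0" using ne by simp
  with \<open>even (length es)\<close> have len: "length es \<ge> 2" by presburger
  have neg: "2 * k \<le> length es" if odd: "odd (?neg es)"
  proof (cases "set es = edges T")
    case True
    have "2 * (2 * k - 2) \<le> card (edges G) * (2 * k - 2)"
      using card_edges_X_critical[OF k wf crit loop] by (rule mult_le_mono1)
    \<comment> \<open>A walk using every edge is at least as long as their number, and 2(2k - 2) is
      at least 2k because k is at least 2.\<close>
    also have "\<dots> = card (edges T)" using T by (simp add: is_T_def card_cartesian_product)
    also have "\<dots> \<le> length es" unfolding True[symmetric] by (rule card_length)
    finally show ?thesis using k by linarith
  next
    case False
    let ?S = "T\<lparr>edges := set es\<rparr>"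
    have E: "set es \<subseteq> edges T" by (rule walk_edges[OF w])
    have wfS: "wf_graph ?S" using wfT E by (auto simp: wf_graph_def)
    hence "proper_subgraph ?S T" using E False by (auto simp: proper_subgraph_def)
    then obtain \<phi> where "circ_map k ?S \<phi>"
      using X_critical_imp_circ_map_subgraph[OF k wf T crit] by blast
    moreover have "\<forall>e\<in>edges ?S. sign ?S e \<in> {1, -1}" using wfS by (simp add: wf_graph_def)
    ultimately show ?thesis
      using closed_walk_length[OF k0 _ _ walk_restrict_edges[OF w order_refl]] odd by simp
  qed
  obtain u c ds where C': "walk C u [c, c] u" "walk C u ds u" "length ds = 2 * k"
    "odd (length (filter (\<lambda>e. sign C e = -1) ds))"
    by (rule negative_cycle_walks[OF k0 C])
  show "\<exists>v ds. walk C v ds v \<and> ds \<noteq> [] \<and> of_nat (length (filter (\<lambda>e. sign C e = -1) ds)) = i \<and>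
      of_nat (length ds) = j \<and> length ds \<le> length es"
  proof (cases "odd (?neg es)")
    case True
    hence "of_nat (length (filter (\<lambda>e. sign C e = -1) ds)) = i" using i C'(4) by (simp add: of_nat_bit_eq)
    moreover have "of_nat (length ds) = j" unfolding j0 C'(3) by (simp add: of_nat_bit_eq)
    moreover have "ds \<noteq> []" using C'(3) k0 by auto
    moreover have "length ds \<le> length es" using neg[OF True] C'(3) by simp
    ultimately show ?thesis using C'(2) by blast
  next
    case False
    hence "i = 0" using i by (simp add: of_nat_bit_eq)
    hence "of_nat (length (filter (\<lambda>e. sign C e = -1) [c, c])) = i" by (simp add: of_nat_bit_eq)
    moreover have "of_nat (length [c, c]) = j" unfolding j0 by (simp add: of_nat_bit_eq)
    ultimately show ?thesis using C'(1) len by (intro exI[of _ u] exI[of _ "[c, c]"]) simp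
  qed
qed

text \<open>The paths of the retained edges keep their signs from \<open>T\<close>, so homomorphisms
  of proper subgraphs of \<open>T\<close> yield colorings of proper subgraphs of
  \<open>G\<close>.\<close>

lemma subdivision_subgraph:
  assumes T: "is_T m G T" and m: "m > 0" and S: "proper_subgraph S G"
  obtains R where "is_T m S R" "proper_subgraph R T"
proof
  let ?R = "T\<lparr>verts := Inl ` verts S \<union> Inr ` (edges S \<times> {0<..<m}), edges := edges S \<times> {..<m}\<rparr>"
  have sub: "wf_graph S" "verts S \<subseteq> verts G" "edges S \<subseteq> edges G"
    "\<forall>e\<in>edges S. ends S e = ends G e \<and> sign S e = sign G e"
    and proper: "verts S \<noteq> verts G \<or> edges S \<noteq> edges G"
    using S unfolding proper_subgraph_def by blast+
  have ET: "edges T = edges G \<times> {..<m}"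
    and VT: "verts T = Inl ` verts G \<union> Inr ` (edges G \<times> {0<..<m})"
    using T by (simp_all add: is_T_def)
  show R: "is_T m S ?R" using T sub(3,4) unfolding is_T_def by (simp add: subset_iff)
  have "verts S = verts G" if "verts ?R = verts T"
  proof -
    have "Inl -` verts ?R = Inl -` verts T" using that by simp
    thus ?thesis unfolding VT by auto
  qed
  moreover have "edges S = edges G" if "edges ?R = edges T"
    using that m unfolding ET by (auto simp: times_eq_iff)
  moreover have "wf_graph ?R" by (rule wf_graph_subdivision[OF sub(1) R])
  moreover have "verts ?R \<subseteq> verts T" "edges ?R \<subseteq> edges T" using sub(2,3) by (auto simp: ET VT)
  ultimately show "proper_subgraph ?R T" using proper unfolding proper_subgraph_def by force
qed

theorem theorem4p1:
  fixes k :: nat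
    and G :: "('v, 'e) signed_multigraph"
    and T :: "('v + 'e \<times> nat, 'e \<times> nat) signed_multigraph"
    and C :: "('w, 'f) signed_multigraph"
  assumes "k \<ge> 2"
    and "wf_graph G"
    and "is_T (2 * k - 2) G T"
    and "is_negative_cycle (2 * k) C"
  shows "(X_colorable k G \<longleftrightarrow> sg_hom T C) \<and>
    (\<not> single_positive_loop G \<longrightarrow>
      (X_critical k G \<longleftrightarrow> hom_critical C T))"
proof -
  have k0: "k > 0" "2 * k - 2 > 0" using assms(1) by simp_all
  \<comment> \<open>Stated for arbitrary pairs, since it is applied to \<open>G\<close> and to its
    proper subgraphs.\<close>
  have hom: "X_colorable k S \<longleftrightarrow> sg_hom R C" if "wf_graph S" "is_T (2 * k - 2) S R"
    for S :: "('v, 'e) signed_multigraph" and R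
    using X_colorable_iff_circ_map[OF assms(1) that]
      sg_hom_iff_circ_map[OF k0(1) assms(4) wf_graph_subdivision[OF that]] by simp
  have "X_critical k G \<longleftrightarrow> hom_critical C T" if loop: "\<not> single_positive_loop G"
  proof
    assume crit: "X_critical k G"
    \<comment> \<open>A proper subgraph of \<open>T\<close> need not be a subdivision, so the map to
      the double cover is used directly.\<close>
    have "sg_hom S C" if S: "proper_subgraph S T" for S
    proof -
      have "wf_graph S" using S by (simp add: proper_subgraph_def)
      from sg_hom_iff_circ_map[OF k0(1) assms(4) this] show ?thesis
        using X_critical_imp_circ_map_subgraph[OF assms(1-3) crit S] by blast
    qed
    thus "hom_critical C T"
      using X_critical_imp_gij[OF assms crit loop] hom[OF assms(2,3)] crit
      unfolding hom_critical_def X_critical_def by blast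
  next
    assume crit: "hom_critical C T"
    have "X_colorable k S" if S: "proper_subgraph S G" for S
    proof -
      obtain R where R: "is_T (2 * k - 2) S R" "proper_subgraph R T"
        by (rule subdivision_subgraph[OF assms(3) k0(2) S])
      have "wf_graph S" using S by (simp add: proper_subgraph_def)
      from hom[OF this R(1)] show ?thesis using crit R(2) by (simp add: hom_critical_def)
    qed
    thus "X_critical k G" using hom[OF assms(2,3)] crit by (simp add: X_critical_def hom_critical_def)
  qed
  thus ?thesis using hom[OF assms(2,3)] by blast
qed

end
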